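(* Let $a,b,m\in\mathbb{Z}$ with $a\ge 2$, $m>1$, $\gcd(b,m)=1$, and $b\ge -(a-2)m-2$, and let $S=S_{a,b}(m)$ and $d=(a-1)m+b$. Let $n$ be the smallest positive integer such that $A_n\ge m$, and let $A=\{A_1,\ldots,A_{n-1}\}$. Then the Frobenius number and the genus of $S$ are given by \[ \operatorname{F}(S)=\max_{0\le \ell\le m-1}\bigl\{d\ell+\mathsf{m}_A(\ell)\,m\bigr\}-m \] and \[ g(S)=\sum_{\ell=0}^{m-1}\mathsf{m}_A(\ell)+\frac{(d-1)(m-1)}{2}. \]
   Context: $\mathbb{N}=\{0,1,2,\dots\}$. Let $T_{a,b}(z)=az+b$, with $T_{a,b}^i$ its $i$-fold composition ($T_{a,b}^0$ the identity), and let $S_{a,b}(m)=\langle T_{a,b}^i(m)\mid i\ge 0\rangle$ be the submonoid of $(\mathbb{N},+)$ generated by the orbit of $m$; under the stated hypotheses it is a numerical semigroup (finite complement in $\mathbb{N}$) whose smallest positive element is $m$. The Frobenius number $\operatorname{F}(S)$ is the largest integer not belonging to $S$, and the genus is $g(S)=|\mathbb{N}\setminus S|$. Set $A_i=(a^i-1)/(a-1)$ for $i\ge 0$ (so $A_1=1$); since $m>1$, $n\ge 2$. The index $\ell$ ranges over integers. $\mathsf{m}_A(\ell)$ is the minimum factorization length of $\ell$ with respect to $A$, i.e. the minimum of $\sum_{i=1}^{n-1}u_i$ over all $(u_1,\ldots,u_{n-1})\in\mathbb{N}^{n-1}$ with $\ell=\sum_{i=1}^{n-1}u_iA_i$. 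*)

theory Defs
  imports Complex_Main
begin

definition affine_map :: "int \<Rightarrow> int \<Rightarrow> int \<Rightarrow> int" where
  "affine_map a b z = a * z + b"

text \<open>Subsets of \<open>\<nat>\<close> are represented as integer sets contained in \<open>\<nat> :: int set\<close>, because
  \<open>b\<close> may be negative and the Frobenius number is by definition an integer.\<close>

definition nat_submonoid :: "int set \<Rightarrow> bool" where
  "nat_submonoid M \<longleftrightarrow> M \<subseteq> \<nat> \<and> 0 \<in> M \<and> (\<forall>x\<in>M. \<forall>y\<in>M. x + y \<in> M)"

text \<open>The intersection of all submonoids of \<open>\<nat>\<close> containing the orbit of \<open>m\<close>; meaningful when the
  orbit lies in \<open>\<nat>\<close>.\<close>

definition orbit_monoid :: "int \<Rightarrow> int \<Rightarrow> int \<Rightarrow> int set" where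
  "orbit_monoid a b m = nat_submonoid hull {(affine_map a b ^^ i) m | i. True}"

definition frobenius_number :: "int set \<Rightarrow> int" where
  "frobenius_number S = (GREATEST x. x \<notin> S)"

definition genus :: "int set \<Rightarrow> nat" where
  "genus S = card (\<nat> - S)"

text \<open>For \<open>a \<ge> 2\<close> the division is exact.\<close>

definition repunit :: "int \<Rightarrow> nat \<Rightarrow> int" where
  "repunit a i = (a ^ i - 1) div (a - 1)"

text \<open>The minimum factorization length of \<open>l\<close> with respect to \<open>A 1, \<dots>, A (n - 1)\<close>; only the values
  of \<open>u\<close> on \<open>{1..<n}\<close> matter.\<close>

definition min_fact_length :: "(nat \<Rightarrow> int) \<Rightarrow> nat \<Rightarrow> int \<Rightarrow> nat" where
  "min_fact_length A n l =
     (LEAST k. \<exists>u :: nat \<Rightarrow> nat. l = (\<Sum>i=1..<n. int (u i) * A i) \<and> k = (\<Sum>i=1..<n. u i))"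

end

theory Submission
  imports Defs
begin

text \<open>The orbit of \<open>m\<close> consists of the integers \<open>m + d A\<^sub>i\<close>, so the elements of \<open>S\<close> are the
  integers \<open>k m + d L\<close> where \<open>L\<close> is a sum of \<open>k\<close> repunits, the repunit \<open>A\<^sub>0 = 0\<close> being allowed.
  The bound on \<open>b\<close> says \<open>d \<ge> m - 2\<close>; together with \<open>\<m>\<^sub>A(l) \<le> l \<le> m - 1\<close> it shows that replacing
  \<open>L = l + q m\<close> by \<open>l\<close> never increases \<open>d L + k m\<close> for the minimal \<open>k\<close>. Hence
  \<open>{d l + \<m>\<^sub>A(l) m | 0 \<le> l < m}\<close> is the Apery set of \<open>S\<close> with respect to \<open>m\<close>, and the two formulas
  are those of Brauer--Shockley and Selmer.\<close>

section \<open>Frobenius number and genus from an Apery set\<close>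

text \<open>The residues of the \<open>w l\<close> are distinct, so an element of \<open>S\<close>
  congruent to \<open>w l\<close> can only come from the index \<open>l\<close>. Hence
  \<open>w l\<close> is the least element of \<open>S\<close> in its class modulo
  \<open>m\<close>.\<close>

lemma mem_apery_iff:
  fixes m :: int
  assumes m: "m > 0"
    and S: "S = {w l + int t * m | l t. l \<in> {0..<m}}"
    and bij: "bij_betw (\<lambda>l. w l mod m) {0..<m} {0..<m}"
    and l: "l \<in> {0..<m}" and x: "x mod m = w l mod m"
  shows "x \<in> S \<longleftrightarrow> w l \<le> x"
proof
  assume "x \<in> S"
  then obtain l' t where l': "l' \<in> {0..<m}" and xe: "x = w l' + int t * m"
    using S by auto
  have "w l' mod m = w l mod m" using x xe by simp
  with bij l l' have "l' = l" by (auto simp: bij_betw_def dest: inj_onD)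
  then show "w l \<le> x" using xe m by simp
next
  assume le: "w l \<le> x"
  from x have "m dvd x - w l" by (rule mod_eq_dvd_iff [THEN iffD1])
  then obtain q where q: "x - w l = m * q" by (rule dvdE)
  have "m * q \<ge> 0" using q le by simp
  then have "q \<ge> 0" using m by (simp add: zero_le_mult_iff)
  then have "x = w l + int (nat q) * m" using q by (simp add: algebra_simps)
  then show "x \<in> S" using S l by blast
qed

text \<open>Brauer--Shockley: in the class of \<open>w l\<close> the largest integer outside
  \<open>S\<close> is \<open>w l - m\<close>, and these classes cover all integers.\<close>

lemma frobenius_number_apery:
  fixes m :: int
  assumes m: "m > 0"
    and S: "S = {w l + int t * m | l t. l \<in> {0..<m}}"
    and bij: "bij_betw (\<lambda>l. w l mod m) {0..<m} {0..<m}"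
  shows "frobenius_number S = Max (w ` {0..<m}) - m"
proof -
  let ?M = "Max (w ` {0..<m})"
  have "?M \<in> w ` {0..<m}" using m by (intro Max_in) auto
  then obtain l0 where l0: "l0 \<in> {0..<m}" and M: "?M = w l0" by auto
  have mem: "x \<in> S \<longleftrightarrow> w l \<le> x" if "l \<in> {0..<m}" "x mod m = w l mod m" for x l
    using mem_apery_iff[OF m S bij that] .
  show ?thesis unfolding frobenius_number_def
  proof (rule Greatest_equality)
    have "(?M - m) mod m = w l0 mod m" using M by simp
    then show "?M - m \<notin> S" using mem[OF l0] M m by simp
  next
    fix y assume y: "y \<notin> S"
    have "y mod m \<in> (\<lambda>l. w l mod m) ` {0..<m}"
      unfolding bij_betw_imp_surj_on[OF bij] using m by simp
    then obtain l where l: "l \<in> {0..<m}" and yl: "y mod m = w l mod m"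
      by (rule imageE)
    have "y < w l" using mem[OF l yl] y by simp
    moreover from yl have "m dvd w l - y" by (metis mod_eq_dvd_iff)
    ultimately have "m \<le> w l - y" by (intro zdvd_imp_le) auto
    moreover have "w l \<le> ?M" using l by simp
    ultimately show "y \<le> ?M - m" by simp
  qed
qed

text \<open>Selmer: the class of \<open>w l\<close> contributes \<open>w l div m\<close> gaps;
  nonnegativity of \<open>w l\<close> makes this quotient a genuine count.\<close>

lemma genus_apery:
  fixes m :: int
  assumes m: "m > 0"
    and S: "S = {w l + int t * m | l t. l \<in> {0..<m}}"
    and bij: "bij_betw (\<lambda>l. w l mod m) {0..<m} {0..<m}"
    and nonneg: "\<And>l. l \<in> {0..<m} \<Longrightarrow> 0 \<le> w l"
  shows "int (genus S) = (\<Sum>l\<in>{0..<m}. w l div m)"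
proof -
  \<comment> \<open>\<open>?f (l, j)\<close> is the \<open>j\<close>-th nonnegative integer, counted
    from 0, in the class of \<open>w l\<close>; the range of \<open>j\<close> in \<open>?D\<close>
    stops just short of \<open>w l\<close> itself.\<close>
  let ?f = "\<lambda>(l, j). w l mod m + j * m"
  let ?D = "SIGMA l:{0..<m}. {0..<w l div m}"
  have mem: "x \<in> S \<longleftrightarrow> w l \<le> x" if "l \<in> {0..<m}" "x mod m = w l mod m" for x l
    using mem_apery_iff[OF m S bij that] .
  have less: "w l mod m + j * m < w l \<longleftrightarrow> j < w l div m" for l j
  proof -
    have "w l = w l mod m + (w l div m) * m" by simp
    then have "w l mod m + j * m < w l \<longleftrightarrow> j * m < (w l div m) * m" by linarith
    then show ?thesis using m by simp
  qed
  have inj: "inj_on ?f ?D"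
  proof (rule inj_onI, clarify)
    fix l j l' j'
    assume l: "l \<in> {0..<m}" "l' \<in> {0..<m}" and e: "w l mod m + j * m = w l' mod m + j' * m"
    from arg_cong[OF e, of "\<lambda>x. x mod m"] have "w l mod m = w l' mod m" by simp
    with bij l have "l = l'" by (auto simp: bij_betw_def dest: inj_onD)
    with e m show "l = l' \<and> j = j'" by simp
  qed
  have "?f ` ?D = \<nat> - S"
  proof (intro equalityI subsetI)
    fix x assume "x \<in> ?f ` ?D"
    then obtain l j where l: "l \<in> {0..<m}" and j: "0 \<le> j" "j < w l div m"
      and x: "x = w l mod m + j * m" by auto
    have "x mod m = w l mod m" using x by simp
    with mem[OF l this] less[of l j] j x have "x \<notin> S" by simp
    moreover have "0 \<le> x" using x j m by simp
    ultimately show "x \<in> \<nat> - S" by (simp add: Nats_altdef1)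
  next
    fix x assume "x \<in> \<nat> - S"
    then have x0: "0 \<le> x" and xS: "x \<notin> S" by (auto simp: Nats_altdef1)
    have "x mod m \<in> (\<lambda>l. w l mod m) ` {0..<m}"
      unfolding bij_betw_imp_surj_on[OF bij] using m by simp
    then obtain l where l: "l \<in> {0..<m}" and xl: "x mod m = w l mod m"
      by (rule imageE)
    have xe: "x = w l mod m + (x div m) * m" using xl by (metis mod_div_mult_eq)
    have "x < w l" using mem[OF l xl] xS by simp
    then have "x div m < w l div m" using less[of l "x div m"] xe by simp
    moreover have "0 \<le> x div m" using x0 m by (simp add: pos_imp_zdiv_nonneg_iff)
    ultimately show "x \<in> ?f ` ?D" using l xe by (intro image_eqI[of _ _ "(l, x div m)"]) auto
  qed
  then have "genus S = card ?D" unfolding genus_def using card_image[OF inj] by simp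
  also have "\<dots> = (\<Sum>l\<in>{0..<m}. nat (w l div m))" by simp
  finally have "int (genus S) = (\<Sum>l\<in>{0..<m}. int (nat (w l div m)))" by simp
  also have "\<dots> = (\<Sum>l\<in>{0..<m}. w l div m)"
    using m nonneg by (intro sum.cong) (auto simp: pos_imp_zdiv_nonneg_iff)
  finally show ?thesis .
qed

section \<open>Quotient sums over a complete residue system\<close>

lemma bij_betw_mult_mod:
  fixes d m :: int
  assumes m: "m > 0" and cop: "coprime d m"
  shows "bij_betw (\<lambda>l. d * l mod m) {0..<m} {0..<m}"
proof -
  have inj: "inj_on (\<lambda>l. d * l mod m) {0..<m}"
  proof (rule inj_onI)
    fix x y assume xy: "x \<in> {0..<m}" "y \<in> {0..<m}" and e: "d * x mod m = d * y mod m"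
    from e have "m dvd d * (x - y)" by (simp add: mod_eq_dvd_iff right_diff_distrib)
    then have "m dvd x - y" using cop by (simp add: coprime_dvd_mult_right_iff coprime_commute)
    then have "x mod m = y mod m" by (simp add: mod_eq_dvd_iff)
    then show "x = y" using xy by simp
  qed
  moreover have "(\<lambda>l. d * l mod m) ` {0..<m} = {0..<m}"
    using inj m by (intro endo_inj_surj) auto
  ultimately show ?thesis by (simp add: bij_betw_def)
qed

lemma sum_int_interval: "0 \<le> m \<Longrightarrow> 2 * (\<Sum>l\<in>{0..<m}. l) = m * (m - 1)" for m :: int
proof (induction m rule: int_ge_induct)
  case (step i)
  have "{0..<i+1} = insert i {0..<i}" using step by auto
  then show ?case using step by (simp add: algebra_simps)
qed simp

text \<open>In \<open>d * l = m * (d * l div m) + d * l mod m\<close> the remainders permute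
  \<open>0, ..., m - 1\<close>, so summing over \<open>l\<close> determines the sum of the
  quotients. Doubling avoids halves in the integers.\<close>

lemma sum_div_apery:
  fixes d m :: int
  assumes m: "m > 0" and cop: "coprime d m"
  shows "2 * (\<Sum>l\<in>{0..<m}. (d * l + c l * m) div m)
           = 2 * (\<Sum>l\<in>{0..<m}. c l) + (d - 1) * (m - 1)"
proof -
  let ?I = "{0..<m}"
  have "(\<Sum>l\<in>?I. d * l mod m) = (\<Sum>l\<in>?I. l)"
    by (rule sum.reindex_bij_betw[OF bij_betw_mult_mod[OF m cop]])
  moreover have "(\<Sum>l\<in>?I. d * l) = (\<Sum>l\<in>?I. m * (d * l div m) + d * l mod m)"
    by simp
  ultimately have "m * (\<Sum>l\<in>?I. d * l div m) = (d - 1) * (\<Sum>l\<in>?I. l)"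
    by (simp only: sum.distrib sum_distrib_left[symmetric]) (simp add: algebra_simps)
  then have "m * (2 * (\<Sum>l\<in>?I. d * l div m)) = (d - 1) * (2 * (\<Sum>l\<in>?I. l))"
    by simp
  also have "\<dots> = m * ((d - 1) * (m - 1))"
    using sum_int_interval[of m] m by simp
  finally have "2 * (\<Sum>l\<in>?I. d * l div m) = (d - 1) * (m - 1)" using m by simp
  moreover have "(\<Sum>l\<in>?I. (d * l + c l * m) div m) = (\<Sum>l\<in>?I. c l) + (\<Sum>l\<in>?I. d * l div m)"
    using m by (simp add: sum.distrib)
  ultimately show ?thesis by simp
qed

section \<open>Repunits and factorizations\<close>

lemma repunit_mult: "a \<ge> 2 \<Longrightarrow> (a - 1) * repunit a i = a ^ i - 1"
  unfolding repunit_def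
  by (rule dvd_mult_div_cancel) (simp add: power_diff_1_eq)

lemma repunit_0 [simp]: "repunit a 0 = 0"
  by (simp add: repunit_def)

lemma repunit_Suc: "a \<ge> 2 \<Longrightarrow> repunit a (Suc i) = a * repunit a i + 1"
proof -
  assume a: "a \<ge> 2"
  have "(a - 1) * repunit a (Suc i) = a * ((a - 1) * repunit a i) + (a - 1)"
    unfolding repunit_mult[OF a] by (simp add: algebra_simps)
  also have "\<dots> = (a - 1) * (a * repunit a i + 1)" by (simp add: algebra_simps)
  finally show ?thesis using a by simp
qed

lemma repunit_1 [simp]: "a \<ge> 2 \<Longrightarrow> repunit a (Suc 0) = 1"
  by (simp add: repunit_Suc)

lemma repunit_nonneg: "a \<ge> 2 \<Longrightarrow> 0 \<le> repunit a i"
  by (induction i) (auto simp: repunit_Suc)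

lemma strict_mono_repunit: "a \<ge> 2 \<Longrightarrow> strict_mono (repunit a)"
proof (rule strict_mono_Suc_iff[THEN iffD2], intro allI)
  fix i assume a: "a \<ge> 2"
  have "1 * repunit a i \<le> a * repunit a i"
    using a repunit_nonneg[OF a, of i] by (intro mult_right_mono) auto
  then show "repunit a i < repunit a (Suc i)" using a by (simp add: repunit_Suc)
qed

text \<open>Guarantees that some repunit reaches \<open>m\<close>, so that the \<open>LEAST\<close>
  defining \<open>n\<close> is attained.\<close>

lemma le_repunit: "a \<ge> 2 \<Longrightarrow> int i \<le> repunit a i"
proof (induction i)
  case (Suc i)
  have "repunit a i < repunit a (Suc i)"
    using strict_mono_repunit[OF Suc.prems] by (simp add: strict_mono_Suc_iff)
  then show ?case using Suc by simp
qed simp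

text \<open>With \<open>d = (a - 1) * m + b\<close> one has \<open>a * m + b = m + d\<close>, so one
  step of the map turns the coefficient \<open>A\<close> of \<open>d\<close> into
  \<open>a * A + 1\<close>, the next repunit.\<close>

lemma funpow_affine_map:
  assumes a: "a \<ge> 2"
  shows "(affine_map a b ^^ i) m = m + ((a - 1) * m + b) * repunit a i"
proof (induction i)
  case (Suc i)
  have "(affine_map a b ^^ Suc i) m = a * (m + ((a - 1) * m + b) * repunit a i) + b"
    by (simp add: Suc) (simp add: affine_map_def)
  also have "\<dots> = m + ((a - 1) * m + b) * (a * repunit a i + 1)" by (simp add: algebra_simps)
  finally show ?case using a by (simp add: repunit_Suc)
qed simp

section \<open>Factorizations as lists of indices\<close>

lemma list_of_multiplicities:
  fixes u :: "nat \<Rightarrow> nat" and A :: "nat \<Rightarrow> int"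
  shows "\<exists>xs. length xs = (\<Sum>i=1..<n. u i) \<and> sum_list (map A xs) = (\<Sum>i=1..<n. int (u i) * A i)"
proof -
  let ?xs = "concat (map (\<lambda>i. replicate (u i) i) [1..<n])"
  have "length ?xs = (\<Sum>i=1..<n. u i)"
    by (simp add: length_concat o_def interv_sum_list_conv_sum_set_nat)
  moreover have "sum_list (map A (concat (map (\<lambda>i. replicate (u i) i) is)))
      = (\<Sum>i\<leftarrow>is. int (u i) * A i)" for "is"
    by (induction "is") (auto simp: sum_list_replicate)
  then have "sum_list (map A ?xs) = (\<Sum>i=1..<n. int (u i) * A i)"
    by (simp add: interv_sum_list_conv_sum_set_nat)
  ultimately show ?thesis by blast
qed

lemma sum_list_map_eq_sum_of_nat_count:
  fixes f :: "'a \<Rightarrow> 'b::comm_semiring_1"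
  assumes "finite X" and "set xs \<subseteq> X"
  shows "sum_list (map f xs) = (\<Sum>x\<in>X. of_nat (count_list xs x) * f x)"
  using assms(2)
proof (induction xs)
  case (Cons y xs)
  have "(\<Sum>x\<in>X. of_nat (count_list (y # xs) x) * f x)
      = (\<Sum>x\<in>X. of_nat (count_list xs x) * f x + (if x = y then f x else 0))"
    by (intro sum.cong) (auto simp: algebra_simps)
  also have "\<dots> = sum_list (map f xs) + f y"
    using Cons assms(1) by (simp add: sum.distrib)
  finally show ?case by (simp add: add.commute)
qed simp

text \<open>The multiplicities of the nonzero entries form a factorization. Entries 0 add nothing to
  the sum because \<open>A 0 = 0\<close>, so dropping them can only shorten the list.\<close>

lemma min_fact_length_le:
  fixes A :: "nat \<Rightarrow> int"
  assumes A0: "A 0 = 0" and xs: "set xs \<subseteq> {..<n}"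
  shows "min_fact_length A n (sum_list (map A xs)) \<le> length xs"
proof -
  let ?u = "count_list xs"
  have fin: "finite {..<n}" by simp
  have "sum_list (map A xs) = (\<Sum>i<n. int (?u i) * A i)"
    using sum_list_map_eq_sum_of_nat_count[OF fin xs, of A] by simp
  also have "\<dots> = (\<Sum>i=1..<n. int (?u i) * A i)"
    using A0 by (intro sum.mono_neutral_right) (auto simp: not_le)
  finally have "min_fact_length A n (sum_list (map A xs)) \<le> (\<Sum>i=1..<n. ?u i)"
    unfolding min_fact_length_def by (intro Least_le) blast
  also have "\<dots> \<le> (\<Sum>i<n. ?u i)" by (intro sum_mono2) auto
  also have "\<dots> = length xs"
    using sum_list_map_eq_sum_of_nat_count[OF fin xs, of "\<lambda>_. 1::nat"] by (simp add: sum_list_triv)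
  finally show ?thesis .
qed

lemma ex_min_fact_list:
  fixes A :: "nat \<Rightarrow> int"
  assumes A1: "A 1 = 1" and n: "2 \<le> n" and l: "0 \<le> l"
  shows "\<exists>xs. length xs = min_fact_length A n l \<and> sum_list (map A xs) = l"
proof -
  let ?P = "\<lambda>k. \<exists>u :: nat \<Rightarrow> nat. l = (\<Sum>i=1..<n. int (u i) * A i) \<and> k = (\<Sum>i=1..<n. u i)"
  \<comment> \<open>Taking \<open>l\<close> copies of \<open>A 1 = 1\<close> shows that a
    factorization exists, so the \<open>LEAST\<close> is attained.\<close>
  let ?u = "\<lambda>i. if i = 1 then nat l else (0::nat)"
  have "(\<Sum>i=1..<n. int (?u i) * A i) = (\<Sum>i=1..<n. if i = 1 then l else 0)"
    using A1 l by (intro sum.cong) auto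
  also have "\<dots> = l" using n by simp
  finally have "?P (\<Sum>i=1..<n. ?u i)" by metis
  then have "?P (min_fact_length A n l)"
    unfolding min_fact_length_def by (rule LeastI)
  then show ?thesis by (metis list_of_multiplicities)
qed

text \<open>The crude bound given by \<open>l\<close> copies of \<open>A 1\<close>;
  \<open>2 \<le> n\<close> makes the index 1 available.\<close>

lemma min_fact_length_self:
  fixes A :: "nat \<Rightarrow> int"
  assumes "A 0 = 0" "A 1 = 1" "2 \<le> n" "0 \<le> l"
  shows "int (min_fact_length A n l) \<le> l"
proof -
  have "set (replicate (nat l) 1) \<subseteq> {..<n}" using assms(3) by (auto simp: set_replicate_conv_if)
  from min_fact_length_le[of A, OF assms(1) this] show ?thesis
    using assms(2,4) by (simp add: sum_list_replicate)
qed

section \<open>The semigroup generated by the orbit\<close>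

text \<open>The finite sums of generators form a submonoid, contained in every submonoid that
  contains the generators; \<open>nonneg\<close> keeps them inside \<open>\<nat>\<close>.\<close>

lemma submonoid_hull_eq_list_sums:
  assumes nonneg: "\<And>i. 0 \<le> g i"
  shows "nat_submonoid hull {g i | i. True} = {sum_list (map g xs) | xs. True}" (is "_ = ?E")
proof (rule hull_unique)
  show "{g i | i. True} \<subseteq> ?E"
  proof clarify
    fix i
    have "g i = sum_list (map g [i])" by simp
    then show "\<exists>xs. g i = sum_list (map g xs) \<and> True" by blast
  qed
  have "x + y \<in> ?E" if "x \<in> ?E" "y \<in> ?E" for x y
  proof -
    from that obtain xs ys where "x = sum_list (map g xs)" "y = sum_list (map g ys)" by blast
    then have "x + y = sum_list (map g (xs @ ys))" by simp
    then show ?thesis by blast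
  qed
  moreover have "0 = sum_list (map g [])" by simp
  then have "0 \<in> ?E" by blast
  moreover have "?E \<subseteq> \<nat>" using nonneg by (auto simp: Nats_altdef1 intro!: sum_list_nonneg)
  ultimately show "nat_submonoid ?E" unfolding nat_submonoid_def by blast
next
  fix T assume gT: "{g i | i. True} \<subseteq> T" and T: "nat_submonoid T"
  have "sum_list (map g xs) \<in> T" for xs
    by (induction xs) (use gT T in \<open>auto simp: nat_submonoid_def\<close>)
  then show "?E \<subseteq> T" by blast
qed

lemma orbit_monoid_eq:
  assumes a: "a \<ge> 2" and m: "m \<ge> 0" and d: "d = (a - 1) * m + b" "d \<ge> 0"
  shows "orbit_monoid a b m
    = {int (length xs) * m + d * sum_list (map (repunit a) xs) | xs. True}"
proof -
  have "sum_list (map (\<lambda>i. m + d * repunit a i) xs)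
      = int (length xs) * m + d * sum_list (map (repunit a) xs)" for xs
    by (induction xs) (auto simp: algebra_simps)
  moreover have "0 \<le> m + d * repunit a i" for i
    using m d repunit_nonneg[OF a, of i] by simp
  ultimately show ?thesis
    unfolding orbit_monoid_def funpow_affine_map[OF a] d(1)[symmetric]
    by (subst submonoid_hull_eq_list_sums) auto
qed

lemma orbit_monoid_apery:
  assumes a: "a \<ge> 2" and m: "m > 1" and d: "d = (a - 1) * m + b" "d \<ge> 0" "d \<ge> m - 2"
    and n: "n \<ge> 2" "repunit a n \<ge> m"
  shows "orbit_monoid a b m
    = {d * l + int (min_fact_length (repunit a) n l) * m + int t * m | l t. l \<in> {0..<m}}"
proof -
  let ?A = "repunit a"
  let ?f = "\<lambda>l. int (min_fact_length ?A n l)"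
  have A1: "?A 1 = 1" using a by simp
  have orbit: "orbit_monoid a b m = {int (length xs) * m + d * sum_list (map ?A xs) | xs. True}"
    using orbit_monoid_eq[OF a _ d(1,2)] m by simp
  show ?thesis
  proof (intro equalityI subsetI)
    fix x assume "x \<in> orbit_monoid a b m"
    then obtain xs where x: "x = int (length xs) * m + d * sum_list (map ?A xs)"
      using orbit by auto
    define L where "L = sum_list (map ?A xs)"
    define l q where "l = L mod m" and "q = L div m"
    have L: "L = l + q * m" by (simp add: l_def q_def)
    have L0: "0 \<le> L" unfolding L_def using repunit_nonneg[OF a] by (auto intro!: sum_list_nonneg)
    have q: "0 \<le> q" using L0 m by (simp add: q_def pos_imp_zdiv_nonneg_iff)
    have l: "l \<in> {0..<m}" using m by (simp add: l_def)
    \<comment> \<open>Since \<open>x = d * l + (int (length xs) + d * q) * m\<close>, this says that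
      \<open>x\<close> exceeds \<open>d * l + ?f l * m\<close> by a nonnegative multiple of
      \<open>m\<close>.\<close>
    have "?f l \<le> int (length xs) + d * q"
    proof (cases "q = 0")
      case True
      \<comment> \<open>As \<open>L < m \<le> ?A n\<close>, no entry of \<open>xs\<close> reaches
        \<open>n\<close>; so \<open>xs\<close> is already a factorization of \<open>L = l\<close>,
        possibly padded with the index 0.\<close>
      have "i < n" if "i \<in> set xs" for i
      proof -
        have "?A i \<le> L" unfolding L_def using that repunit_nonneg[OF a]
          by (intro member_le_sum_list) auto
        also have "\<dots> < ?A n" using True L l n by simp
        finally show ?thesis using strict_mono_less[OF strict_mono_repunit[OF a]] by simp
      qed
      then have "min_fact_length ?A n L \<le> length xs"
        unfolding L_def by (intro min_fact_length_le) auto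
      then show ?thesis using True L by simp
    next
      case False
      \<comment> \<open>Now \<open>L \<ge> m\<close> forces \<open>xs\<close> to be nonempty, and
        \<open>length xs + d * q \<ge> 1 + d \<ge> m - 1 \<ge> l \<ge> ?f l\<close>.\<close>
      then have "1 * m \<le> q * m" using q m by (intro mult_right_mono) auto
      then have "L > 0" using L l m unfolding atLeastLessThan_iff by linarith
      then have "xs \<noteq> []" by (auto simp: L_def)
      then have "1 \<le> int (length xs)" by (cases xs) auto
      moreover have "d * 1 \<le> d * q" using d False q by (intro mult_left_mono) auto
      moreover have "?f l \<le> l" using min_fact_length_self[of ?A n l] A1 n l by simp
      ultimately show ?thesis using d l by simp
    qed
    then have "x = d * l + ?f l * m + int (nat (int (length xs) + d * q - ?f l)) * m"
      using x unfolding L_def[symmetric] L by (simp add: algebra_simps)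
    then show "x \<in> {d * l + ?f l * m + int t * m | l t. l \<in> {0..<m}}" using l by blast
  next
    fix x assume "x \<in> {d * l + ?f l * m + int t * m | l t. l \<in> {0..<m}}"
    then obtain l t where l: "l \<in> {0..<m}" and x: "x = d * l + ?f l * m + int t * m" by blast
    obtain xs where "length xs = min_fact_length ?A n l" "sum_list (map ?A xs) = l"
      using ex_min_fact_list[of ?A n l] A1 n l by auto
    \<comment> \<open>Each appended index 0 contributes one more \<open>m\<close> through the length
      and nothing to the sum, as \<open>?A 0 = 0\<close>.\<close>
    then have "x = int (length (xs @ replicate t 0)) * m
        + d * sum_list (map ?A (xs @ replicate t 0))"
      using x by (simp add: algebra_simps sum_list_replicate)
    then show "x \<in> orbit_monoid a b m" using orbit by blast
  qed
qed

theorem corollary4p8: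
  fixes a b m d :: int and n :: nat and S :: "int set"
  assumes "a \<ge> 2" and "m > 1" and "gcd b m = 1" and "b \<ge> - (a - 2) * m - 2"
    and "S = orbit_monoid a b m"
    and "d = (a - 1) * m + b"
    and "n = (LEAST k. 0 < k \<and> repunit a k \<ge> m)"
  shows "frobenius_number S =
           Max {d * l + int (min_fact_length (repunit a) n l) * m | l. 0 \<le> l \<and> l \<le> m - 1} - m \<and>
         real (genus S) =
           (\<Sum>l=0..m-1. real (min_fact_length (repunit a) n l))
             + (real_of_int d - 1) * (real_of_int m - 1) / 2"
proof -
  note a = assms(1) and m = assms(2) and d = assms(6)
  let ?c = "\<lambda>l. int (min_fact_length (repunit a) n l)"
  let ?w = "\<lambda>l. d * l + ?c l * m"
  have d2: "d \<ge> m - 2" using assms(4) d by (simp add: algebra_simps)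
  then have d0: "d \<ge> 0" using m by simp
  \<comment> \<open>\<open>d\<close> and \<open>b\<close> differ by a multiple of
    \<open>m\<close>.\<close>
  have "gcd d m = gcd b m" unfolding d by (metis gcd.commute gcd_add_mult)
  then have cop: "coprime d m" using assms(3) by (simp add: coprime_iff_gcd_eq_1)
  have "0 < nat m \<and> repunit a (nat m) \<ge> m" using le_repunit[OF a, of "nat m"] m by simp
  then have n: "0 < n \<and> repunit a n \<ge> m" unfolding assms(7) by (rule LeastI)
  \<comment> \<open>The first repunit is \<open>1 < m\<close>.\<close>
  moreover have "n \<noteq> 1" using n a m by auto
  ultimately have n2: "n \<ge> 2" by simp
  have m0: "m > 0" using m by simp
  have S: "S = {?w l + int t * m | l t. l \<in> {0..<m}}"
    using orbit_monoid_apery[OF a m d d0 d2 n2] n assms(5) by simp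
  have bij: "bij_betw (\<lambda>l. ?w l mod m) {0..<m} {0..<m}"
    using bij_betw_mult_mod[OF m0 cop] by simp
  have I: "{0..m-1} = {0..<m}" by auto
  have "{?w l | l. 0 \<le> l \<and> l \<le> m - 1} = ?w ` {0..<m}" by (auto simp: image_iff)
  then have "frobenius_number S = Max {?w l | l. 0 \<le> l \<and> l \<le> m - 1} - m"
    using frobenius_number_apery[OF m0 S bij] by simp
  \<comment> \<open>The identity stays doubled in the integers and is halved only after passing to
    the reals.\<close>
  moreover have "2 * int (genus S) = 2 * (\<Sum>l\<in>{0..<m}. ?c l) + (d - 1) * (m - 1)"
    using genus_apery[OF m0 S bij] sum_div_apery[OF m0 cop, of ?c] d0 m0 by simp
  then have "real_of_int (2 * int (genus S))
      = real_of_int (2 * (\<Sum>l\<in>{0..<m}. ?c l) + (d - 1) * (m - 1))" by (rule arg_cong)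
  then have "real (genus S) = (\<Sum>l=0..m-1. real (min_fact_length (repunit a) n l))
      + (real_of_int d - 1) * (real_of_int m - 1) / 2"
    unfolding I by simp
  ultimately show ?thesis by blast
qed

end
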